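(* Let $1\le m<n$ be integers and let $X$ be a set with $|X|=\aleph_1$. Then $\eta(\sigma_m(2^X),\sigma_n(2^X)) = 2n-2m+1$.
   Context: For a set $X$ and a natural number $n$, $\sigma_n(2^X)=\{\chi_A\in\{0,1\}^X : A\subset X,\ |A|\le n\}$, where $\chi_A$ is the characteristic function of $A$, with the topology inherited from the product space $\{0,1\}^X$ ($\{0,1\}$ discrete); it is a compact space. For $m<n$, $\sigma_m(2^X)$ is a closed subspace of $\sigma_n(2^X)$. For a compact Hausdorff space $K$, $C(K)$ is the Banach space of continuous real-valued functions on $K$ with the supremum norm. If $L\subset K$ is a closed subspace, a bounded linear operator $T:C(L)\to C(K)$ is an extension operator if $(Tf)|_L=f$ for every $f\in C(L)$. Put $\eta(L,K)=\inf\{\|T\| : T:C(L)\to C(K)\text{ is an extension operator}\}$, with $\eta(L,K)=\infty$ if there is no extension operator. *)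

theory Defs
  imports "HOL-Analysis.Analysis"
begin

(* Every topology here is an abstract one on an explicit carrier.  Points of the cube
   {0,1}^X are functions extensional on X, elements of C(K) are functions extensional
   on topspace K. *)

definition char_fun :: "'a set \<Rightarrow> 'a set \<Rightarrow> 'a \<Rightarrow> nat" where
  "char_fun X A = restrict (indicator A) X"

definition cube :: "'a set \<Rightarrow> ('a \<Rightarrow> nat) topology" where
  "cube X = product_topology (\<lambda>_. discrete_topology {0, 1}) X"

definition sigma_cube :: "nat \<Rightarrow> 'a set \<Rightarrow> ('a \<Rightarrow> nat) topology" where
  "sigma_cube n X =
     subtopology (cube X) {char_fun X A | A. A \<subseteq> X \<and> finite A \<and> card A \<le> n}"

(* The functions in the library's cfunspace are required to be bounded, which is
   automatic when K is compact. *)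
definition C_space :: "'b topology \<Rightarrow> ('b \<Rightarrow> real) set" where
  "C_space K = mspace (cfunspace K euclidean_metric)"

definition C_norm :: "'b topology \<Rightarrow> ('b \<Rightarrow> real) \<Rightarrow> real" where
  "C_norm K f = mdist (cfunspace K euclidean_metric) f (restrict (\<lambda>_. 0) (topspace K))"

definition bounded_operator ::
  "'b topology \<Rightarrow> 'c topology \<Rightarrow> (('b \<Rightarrow> real) \<Rightarrow> ('c \<Rightarrow> real)) \<Rightarrow> bool" where
  "bounded_operator L K T \<longleftrightarrow>
     T \<in> C_space L \<rightarrow> C_space K \<and>
     (\<forall>f\<in>C_space L. \<forall>g\<in>C_space L. \<forall>x\<in>topspace K.
        T (restrict (\<lambda>y. f y + g y) (topspace L)) x = T f x + T g x) \<and>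
     (\<forall>c. \<forall>f\<in>C_space L. \<forall>x\<in>topspace K.
        T (restrict (\<lambda>y. c * f y) (topspace L)) x = c * T f x) \<and>
     (\<exists>B. \<forall>f\<in>C_space L. C_norm K (T f) \<le> B * C_norm L f)"

definition op_norm ::
  "'b topology \<Rightarrow> 'c topology \<Rightarrow> (('b \<Rightarrow> real) \<Rightarrow> ('c \<Rightarrow> real)) \<Rightarrow> real" where
  "op_norm L K T = (SUP f\<in>{f \<in> C_space L. C_norm L f \<le> 1}. C_norm K (T f))"

(* Meant for L a closed subspace of K. *)
definition extension_operator ::
  "'b topology \<Rightarrow> 'b topology \<Rightarrow> (('b \<Rightarrow> real) \<Rightarrow> ('b \<Rightarrow> real)) \<Rightarrow> bool" where
  "extension_operator L K T \<longleftrightarrow>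
     bounded_operator L K T \<and> (\<forall>f\<in>C_space L. \<forall>x\<in>topspace L. T f x = f x)"

(* In ereal the infimum of the empty set is infinity. *)
definition eta :: "'b topology \<Rightarrow> 'b topology \<Rightarrow> ereal" where
  "eta L K = (INF T\<in>{T. extension_operator L K T}. ereal (op_norm L K T))"

lemma topspace_sigma_cube:
  "topspace (sigma_cube n X) = {char_fun X A | A. A \<subseteq> X \<and> finite A \<and> card A \<le> n}"
  by (auto simp: sigma_cube_def cube_def char_fun_def indicator_def)

lemma closedin_cube_sigma_cube: "closedin (cube X) (topspace (sigma_cube n X))"
proof -
  let ?U = "\<lambda>F. {f \<in> topspace (cube X). \<forall>x\<in>F. f x \<in> {1}}"
  let ?\<F> = "{F. F \<subseteq> X \<and> finite F \<and> card F = Suc n}"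
  have "openin (cube X) (?U F)" if F: "F \<in> ?\<F>" for F
  proof -
    have "openin (cube X) {f \<in> topspace (cube X). f x \<in> {1}}" if "x \<in> F" for x
      using that F unfolding cube_def
      by (intro openin_continuous_map_preimage[of _ "discrete_topology {0,1}"]
          continuous_map_product_projection) auto
    moreover have "F \<noteq> {}"
      using F by auto
    moreover from this have "?U F = (\<Inter>x\<in>F. {f \<in> topspace (cube X). f x \<in> {1}})"
      by auto
    ultimately show ?thesis
      using F by (simp add: openin_INT2)
  qed
  then have "openin (cube X) (\<Union>F\<in>?\<F>. ?U F)"
    by (intro openin_Union) auto
  moreover have "topspace (cube X) - topspace (sigma_cube n X) = (\<Union>F\<in>?\<F>. ?U F)"
  proof (intro set_eqI iffI)
    fix f assume f: "f \<in> topspace (cube X) - topspace (sigma_cube n X)"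
    let ?A = "{x \<in> X. f x = 1}"
    have "f = char_fun X ?A"
      using f by (auto simp: cube_def char_fun_def indicator_def fun_eq_iff PiE_def
          extensional_def Pi_def)
    then have "\<not> (finite ?A \<and> card ?A \<le> n)"
      using f by (auto simp: topspace_sigma_cube)
    then have "infinite ?A \<or> Suc n \<le> card ?A"
      by (simp add: not_less_eq_eq)
    then obtain F where "F \<subseteq> ?A" "finite F" "card F = Suc n"
      using infinite_arbitrarily_large[of ?A "Suc n"] obtain_subset_with_card_n[of "Suc n" ?A]
      by metis
    then show "f \<in> (\<Union>F\<in>?\<F>. ?U F)"
      using f by (intro UN_I[of F]) auto
  next
    fix f assume "f \<in> (\<Union>F\<in>?\<F>. ?U F)"
    then obtain F where F: "F \<subseteq> X" "card F = Suc n" "f \<in> ?U F"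
      by auto
    have "f \<noteq> char_fun X A" if "finite A" "card A \<le> n" for A
    proof
      assume "f = char_fun X A"
      have "F \<subseteq> A"
      proof
        fix x assume "x \<in> F"
        then have "char_fun X A x = 1" "x \<in> X"
          using F \<open>f = char_fun X A\<close> by auto
        then show "x \<in> A"
          by (cases "x \<in> A") (simp_all add: char_fun_def)
      qed
      then have "card F \<le> card A"
        using that(1) by (rule card_mono[rotated])
      then show False
        using that(2) F(2) by linarith
    qed
    then show "f \<in> topspace (cube X) - topspace (sigma_cube n X)"
      using F(3) unfolding topspace_sigma_cube by blast
  qed
  moreover have "topspace (sigma_cube n X) \<subseteq> topspace (cube X)"
    by (simp add: sigma_cube_def)
  ultimately show ?thesis
    by (metis closedin_def)
qed

lemma compact_space_sigma_cube: "compact_space (sigma_cube n X)"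
proof -
  have "compact_space (cube X)"
    by (simp add: cube_def compact_space_product_topology compact_space_discrete_topology)
  then have "compactin (cube X) (topspace (sigma_cube n X))"
    using closedin_compact_space closedin_cube_sigma_cube by blast
  then show ?thesis
    by (metis compact_space_subtopology sigma_cube_def topspace_sigma_cube)
qed

lemma Hausdorff_space_sigma_cube: "Hausdorff_space (sigma_cube n X)"
  by (simp add: sigma_cube_def cube_def Hausdorff_space_subtopology
      Hausdorff_space_product_topology)

lemma sigma_cube_closed_subspace:
  assumes "m \<le> n"
  shows "closedin (sigma_cube n X) (topspace (sigma_cube m X))"
    and "subtopology (sigma_cube n X) (topspace (sigma_cube m X)) = sigma_cube m X"
proof -
  have sub: "topspace (sigma_cube m X) \<subseteq> topspace (sigma_cube n X)"
    using assms by (fastforce simp: topspace_sigma_cube)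
  have eq: "sigma_cube k X = subtopology (cube X) (topspace (sigma_cube k X))" for k
    by (metis sigma_cube_def topspace_sigma_cube)
  show "closedin (sigma_cube n X) (topspace (sigma_cube m X))"
    by (metis closedin_cube_sigma_cube closedin_subset_topspace eq sub)
  show "subtopology (sigma_cube n X) (topspace (sigma_cube m X)) = sigma_cube m X"
    by (metis eq inf.absorb_iff2 sub subtopology_subtopology)
qed

lemma C_space_compact:
  assumes "compact_space K"
  shows "C_space K = {f \<in> extensional (topspace K). continuous_map K euclideanreal f}"
proof -
  have "bounded (f ` topspace K)" if "continuous_map K euclideanreal f" for f
    using image_compactin[OF _ that] assms
    by (simp add: compact_space_def compact_imp_bounded)
  then show ?thesis
    by (auto simp: C_space_def)
qed

lemma C_norm_eq_SUP:
  assumes "f \<in> C_space K" "topspace K \<noteq> {}"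
  shows "C_norm K f = (SUP x\<in>topspace K. \<bar>f x\<bar>)"
proof -
  let ?z = "restrict (\<lambda>_. 0::real) (topspace K)"
  have z: "?z \<in> C_space K"
    unfolding C_space_def by (auto simp:
        continuous_map_eq[OF continuous_map_const[THEN iffD2]] image_constant_conv)
  have "f \<in> Metric_space.fspace UNIV dist (topspace K)"
       "?z \<in> Metric_space.fspace UNIV dist (topspace K)"
    using assms(1) z cfunspace_subset_funspace[of K euclidean_metric]
    by (auto simp: C_space_def)
  then show ?thesis
    using assms(2)
    by (auto simp: C_norm_def mdist_cfunspace_eq_mdist_funspace Met_TC.fdist_def
        intro!: SUP_cong)
qed

end

theory Submission
  imports Defs "HOL-Library.Countable_Set_Type"
begin

text \<open>
  Functions on \<sigma>_k(2^X) are regarded as functions h of finite subsets of X with at most k elements.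
  By compactness, h is continuous exactly when for every \<epsilon> > 0 there is a finite set \<Phi> such
  that |h A - h B| < \<epsilon> whenever A and B have the same trace on \<Phi>
  (finitely_controlled_of_C_space, on_sigma_in_C_space).  All further work takes place on finite sets.

  Upper bound.  Order X in type \<omega>_1.  The telescoping identity
  h A = h {} + (\<Sum>c\<in>A. h ({c} \<union> A_c) - h A_c), with A_c the set of elements of A below c, does not
  make sense on \<sigma>_n when h is defined on \<sigma>_m only, because A_c may be too big.  But c has only
  countably many predecessors, and for a countable set there is a continuous retraction of its finite
  subsets onto those of at most m - 1 elements: keep the first m - 1 elements in a fixed enumeration.
  Replacing A_c by its retract defines an extension operator (extend).  The result is continuous
  because h ({c} \<union> D) - h D is uniformly small in D for all c outside a finite set, so that up to
  \<epsilon> only finitely many c matter (finitely_controlled_extend).  The first m elements of A still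
  telescope to one value of h, and each of the remaining n - m elements adds two values, which
  gives the norm 2(n - m) + 1 (abs_extend_le).

  Lower bound.  Let T be an extension operator, and let S have m - 1 elements.  For x not in S the
  point S \<union> {x} is isolated in \<sigma>_m, and T of its characteristic function is nearly 1 at all
  S \<union> {x} \<union> G with G avoiding a finite set that depends on x.  As X is uncountable, there is a set R of
  n - m + 1 points that is free for this set mapping (free_subset_of_uncountable), so at S \<union> R all
  these values are nearly 1.  On the other hand, T of the characteristic function of all sets including
  S is also nearly 1 there if R avoids one more finite set.  A function that is -1 at the n - m + 1 points S \<union> {x} and 1
  at all other sets including S is therefore sent to a function with value about
  1 - 2(n - m + 1) at S \<union> R (extension_operator_norm_ge).
\<close>

section \<open>Free sets\<close>

text \<open>
  Induction on the bound d.  If some point r lies in \<Phi> y for infinitely many y, restrict to these y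
  and discard r: the traces of the sets \<Phi> y on what remains have lost a point, so the bound drops.
  Otherwise every point of Y lies in only finitely many of the sets \<Phi> y, and a free set can be
  enlarged greedily, because a finite set R excludes only finitely many new points: those of R, those
  of the sets \<Phi> r, and those x whose \<Phi> x meets R.
\<close>

lemma free_subset_of_bounded:
  assumes "infinite Y" and "\<And>y. y \<in> Y \<Longrightarrow> finite (\<Phi> y) \<and> card (\<Phi> y \<inter> Y) \<le> d"
  shows "\<exists>R\<subseteq>Y. finite R \<and> card R = k \<and> (\<forall>x\<in>R. \<Phi> x \<inter> R \<subseteq> {x})"
  using assms
proof (induction d arbitrary: Y rule: less_induct)
  case (less d)
  show ?case
  proof (cases "\<exists>r\<in>Y. infinite {y \<in> Y. r \<in> \<Phi> y}")
    case True
    then obtain r where r: "r \<in> Y" "infinite {y \<in> Y. r \<in> \<Phi> y}" by blast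
    define Z where "Z = {y \<in> Y. r \<in> \<Phi> y} - {r}"
    have inf: "infinite Z"
      using r(2) by (simp add: Z_def)
    have lt: "card (\<Phi> y \<inter> Z) < d" if "y \<in> Z" for y
    proof -
      have "finite (\<Phi> y \<inter> Y)" "\<Phi> y \<inter> Z \<subset> \<Phi> y \<inter> Y"
        using less.prems(2) that r(1) by (auto simp: Z_def)
      then have "card (\<Phi> y \<inter> Z) < card (\<Phi> y \<inter> Y)"
        by (rule psubset_card_mono)
      then show ?thesis
        using less.prems(2)[of y] that by (auto simp: Z_def)
    qed
    obtain z where "z \<in> Z" using inf by fastforce
    then have "d - 1 < d" using lt by fastforce
    moreover have "finite (\<Phi> y) \<and> card (\<Phi> y \<inter> Z) \<le> d - 1" if "y \<in> Z" for y
      using lt[OF that] less.prems(2) that by (auto simp: Z_def)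
    ultimately obtain R where "R \<subseteq> Z" "finite R" "card R = k" "\<forall>x\<in>R. \<Phi> x \<inter> R \<subseteq> {x}"
      using less.IH[OF _ inf] by blast
    then show ?thesis
      by (intro exI[of _ R]) (auto simp: Z_def)
  next
    case False
    show ?thesis
    proof (induction k)
      case 0
      show ?case by (intro exI[of _ "{}"]) auto
    next
      case (Suc k)
      then obtain R where R: "R \<subseteq> Y" "finite R" "card R = k" "\<forall>x\<in>R. \<Phi> x \<inter> R \<subseteq> {x}"
        by blast
      have "finite (R \<union> (\<Union>r\<in>R. \<Phi> r) \<union> (\<Union>r\<in>R. {y \<in> Y. r \<in> \<Phi> y}))"
        using R False less.prems(2) by blast
      then obtain x where "x \<in> Y" "x \<notin> R" "\<forall>r\<in>R. x \<notin> \<Phi> r" "\<forall>r\<in>R. r \<notin> \<Phi> x"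
        using less.prems(1) by (smt (verit, best) UN_I UnI1 UnI2 finite_subset mem_Collect_eq subsetI)
      then show ?case
        using R by (intro exI[of _ "insert x R"]) auto
    qed
  qed
qed

text \<open>
  Some bound on the cardinality of \<Phi> y holds for infinitely many y, since countably many bounds
  exhaust an uncountable set.
\<close>

lemma free_subset_of_uncountable:
  assumes "uncountable Y" and "\<And>y. y \<in> Y \<Longrightarrow> finite (\<Phi> y)"
  obtains R where "R \<subseteq> Y" "finite R" "card R = k" "\<forall>x\<in>R. \<Phi> x \<inter> R \<subseteq> {x}"
proof -
  let ?Y = "\<lambda>d. {y \<in> Y. card (\<Phi> y) \<le> d}"
  have "\<not> (\<forall>d. countable (?Y d))"
  proof
    assume "\<forall>d. countable (?Y d)"
    then have "countable (\<Union>d. ?Y d)" by simp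
    moreover have "(\<Union>d. ?Y d) = Y" by auto
    ultimately show False using assms(1) by simp
  qed
  then obtain d where d: "infinite (?Y d)"
    using countable_finite by blast
  have "finite (\<Phi> y) \<and> card (\<Phi> y \<inter> ?Y d) \<le> d" if "y \<in> ?Y d" for y
    using card_mono[of "\<Phi> y" "\<Phi> y \<inter> ?Y d"] assms(2) that by simp
  then have "\<exists>R\<subseteq>?Y d. finite R \<and> card R = k \<and> (\<forall>x\<in>R. \<Phi> x \<inter> R \<subseteq> {x})"
    by (rule free_subset_of_bounded[OF d])
  then obtain R where R: "R \<subseteq> ?Y d" "finite R" "card R = k" "\<forall>x\<in>R. \<Phi> x \<inter> R \<subseteq> {x}"
    by (elim exE conjE)
  show ?thesis
  proof (rule that)
    show "R \<subseteq> Y" using R(1) by blast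
  qed (fact R)+
qed

section \<open>Continuous functions on spaces of small sets\<close>

text \<open>
  A point of \<sigma>_k is the characteristic function of a unique set in small_sets k X, so functions
  on \<sigma>_k are handled below as functions of finite sets; on_sigma translates back.
\<close>

definition small_sets :: "nat \<Rightarrow> 'a set \<Rightarrow> 'a set set" where
  "small_sets k X = {A. A \<subseteq> X \<and> finite A \<and> card A \<le> k}"

definition ones :: "'a set \<Rightarrow> ('a \<Rightarrow> nat) \<Rightarrow> 'a set" where
  "ones X p = {x \<in> X. p x = 1}"

definition on_sigma :: "nat \<Rightarrow> 'a set \<Rightarrow> ('a set \<Rightarrow> real) \<Rightarrow> ('a \<Rightarrow> nat) \<Rightarrow> real" where
  "on_sigma k X h = restrict (\<lambda>p. h (ones X p)) (topspace (sigma_cube k X))"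

text \<open>
  Uniform continuity of h with respect to the uniformity that the product {0,1}^X induces: up to
  \<epsilon>, the value h A depends only on finitely many coordinates of A.
\<close>

definition finitely_controlled :: "nat \<Rightarrow> 'a set \<Rightarrow> ('a set \<Rightarrow> real) \<Rightarrow> bool" where
  "finitely_controlled k X h \<longleftrightarrow> (\<forall>\<epsilon>>0. \<exists>\<Phi>. finite \<Phi> \<and>
     (\<forall>A\<in>small_sets k X. \<forall>B\<in>small_sets k X. A \<inter> \<Phi> = B \<inter> \<Phi> \<longrightarrow> \<bar>h A - h B\<bar> < \<epsilon>))"

lemma finitely_controlledI:
  assumes "\<And>\<epsilon>. \<epsilon> > 0 \<Longrightarrow> \<exists>\<Phi>. finite \<Phi> \<and>
     (\<forall>A\<in>small_sets k X. \<forall>B\<in>small_sets k X. A \<inter> \<Phi> = B \<inter> \<Phi> \<longrightarrow> \<bar>h A - h B\<bar> < \<epsilon>)"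
  shows "finitely_controlled k X h"
  using assms by (simp add: finitely_controlled_def)

lemma finitely_controlledE:
  assumes "finitely_controlled k X h" "\<epsilon> > 0"
  obtains \<Phi> where "finite \<Phi>"
    "\<And>A B. A \<in> small_sets k X \<Longrightarrow> B \<in> small_sets k X \<Longrightarrow> A \<inter> \<Phi> = B \<inter> \<Phi> \<Longrightarrow> \<bar>h A - h B\<bar> < \<epsilon>"
proof -
  have "\<exists>\<Phi>. finite \<Phi> \<and>
      (\<forall>A\<in>small_sets k X. \<forall>B\<in>small_sets k X. A \<inter> \<Phi> = B \<inter> \<Phi> \<longrightarrow> \<bar>h A - h B\<bar> < \<epsilon>)"
    using assms by (simp add: finitely_controlled_def)
  then show ?thesis
    using that by (elim exE conjE) simp
qed

lemma topspace_sigma_cube_image: "topspace (sigma_cube k X) = char_fun X ` small_sets k X"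
  by (auto simp: topspace_sigma_cube small_sets_def)

lemma ones_char_fun [simp]: "A \<subseteq> X \<Longrightarrow> ones X (char_fun X A) = A"
  by (auto simp: ones_def char_fun_def indicator_def)

lemma on_sigma_char_fun [simp]:
  "A \<in> small_sets k X \<Longrightarrow> on_sigma k X h (char_fun X A) = h A"
  by (auto simp: on_sigma_def topspace_sigma_cube_image small_sets_def)

lemma openin_sigma_cube_cylinder:
  assumes "finite \<Phi>" "B \<subseteq> X"
  shows "openin (sigma_cube k X) (char_fun X ` {A \<in> small_sets k X. A \<inter> \<Phi> = B \<inter> \<Phi>})"
proof -
  let ?K = "topspace (sigma_cube k X)"
  have "openin (sigma_cube k X) {p \<in> ?K. p x \<in> {char_fun X B x}}" if "x \<in> X" for x
  proof (rule openin_continuous_map_preimage)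
    show "continuous_map (sigma_cube k X) (discrete_topology {0, 1}) (\<lambda>p. p x)"
      using that unfolding sigma_cube_def cube_def
      by (intro continuous_map_from_subtopology continuous_map_product_projection)
    show "openin (discrete_topology {0, 1}) {char_fun X B x}"
      using that by (auto simp: char_fun_def indicator_def)
  qed
  then have "openin (sigma_cube k X) (?K \<inter> (\<Inter>x\<in>\<Phi> \<inter> X. {p \<in> ?K. p x \<in> {char_fun X B x}}))"
    using assms by (cases "\<Phi> \<inter> X = {}") (auto intro!: openin_Int openin_INT2)
  moreover have "?K \<inter> (\<Inter>x\<in>\<Phi> \<inter> X. {p \<in> ?K. p x \<in> {char_fun X B x}})
      = char_fun X ` {A \<in> small_sets k X. A \<inter> \<Phi> = B \<inter> \<Phi>}"
  proof -
    have "(\<forall>x\<in>\<Phi> \<inter> X. char_fun X A x = char_fun X B x) \<longleftrightarrow> A \<inter> \<Phi> = B \<inter> \<Phi>"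
      if "A \<in> small_sets k X" for A
      using that assms(2)
      by (auto simp: char_fun_def small_sets_def indicator_def split: if_splits)
    then show ?thesis
      unfolding topspace_sigma_cube_image by auto
  qed
  ultimately show ?thesis by simp
qed

text \<open>
  A basic open set of the product restricts only finitely many coordinates.
\<close>

lemma cylinder_in_openin_sigma_cube:
  assumes U: "openin (sigma_cube k X) U" "char_fun X B \<in> U" and B: "B \<in> small_sets k X"
  obtains \<Phi> where "finite \<Phi>"
    "\<And>A. A \<in> small_sets k X \<Longrightarrow> A \<inter> \<Phi> = B \<inter> \<Phi> \<Longrightarrow> char_fun X A \<in> U"
proof -
  obtain V where V: "openin (cube X) V" "U = V \<inter> topspace (sigma_cube k X)"
    using U(1) by (metis openin_subtopology sigma_cube_def topspace_sigma_cube)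
  then obtain W where W: "finite {i \<in> X. W i \<noteq> topspace (discrete_topology {0, 1})}"
      "char_fun X B \<in> Pi\<^sub>E X W" "Pi\<^sub>E X W \<subseteq> V"
    using U(2) unfolding cube_def openin_product_topology_alt by blast
  have "char_fun X A \<in> U"
    if A: "A \<in> small_sets k X"
      and eq: "A \<inter> {i \<in> X. W i \<noteq> {0, 1}} = B \<inter> {i \<in> X. W i \<noteq> {0, 1}}" for A
  proof -
    have "char_fun X A i \<in> W i" if "i \<in> X" for i
    proof (cases "W i = {0, 1}")
      case True
      then show ?thesis using that by (auto simp: char_fun_def indicator_def)
    next
      case False
      then have "i \<in> A \<longleftrightarrow> i \<in> B"
        using eq that by blast
      then have "char_fun X A i = char_fun X B i"
        by (simp add: char_fun_def indicator_def)
      then show ?thesis using W(2) that by (auto simp: PiE_iff)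
    qed
    then have "char_fun X A \<in> Pi\<^sub>E X W"
      by (simp add: PiE_iff char_fun_def)
    then show ?thesis
      using W(3) V(2) A by (auto simp: topspace_sigma_cube_image)
  qed
  then show ?thesis
    using W(1) by (intro that[of "{i \<in> X. W i \<noteq> {0, 1}}"]) auto
qed

text \<open>
  Compactness gives uniform continuity.  Around each B the function varies by less than \<epsilon>/2
  on a cylinder over a finite set \<Phi> B; finitely many of these cylinders cover the space, and the
  union of their finite sets controls the function everywhere.
\<close>

lemma finitely_controlled_of_C_space:
  assumes g: "g \<in> C_space (sigma_cube k X)"
  shows "finitely_controlled k X (\<lambda>A. g (char_fun X A))"
proof (rule finitely_controlledI)
  fix \<epsilon> :: real assume "\<epsilon> > 0"
  have cont: "continuous_map (sigma_cube k X) euclideanreal g"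
    using g C_space_compact[OF compact_space_sigma_cube] by blast
  have "\<exists>\<Phi>. finite \<Phi> \<and> (\<forall>A\<in>small_sets k X. A \<inter> \<Phi> = B \<inter> \<Phi> \<longrightarrow>
      \<bar>g (char_fun X A) - g (char_fun X B)\<bar> < \<epsilon> / 2)" if B: "B \<in> small_sets k X" for B
  proof -
    let ?U = "{p \<in> topspace (sigma_cube k X). g p \<in> ball (g (char_fun X B)) (\<epsilon> / 2)}"
    have "openin (sigma_cube k X) ?U"
      by (rule openin_continuous_map_preimage[OF cont]) (simp flip: open_openin)
    moreover have "char_fun X B \<in> ?U"
      using \<open>\<epsilon> > 0\<close> B by (auto simp: topspace_sigma_cube_image)
    ultimately obtain \<Phi> where "finite \<Phi>"
        "\<And>A. A \<in> small_sets k X \<Longrightarrow> A \<inter> \<Phi> = B \<inter> \<Phi> \<Longrightarrow> char_fun X A \<in> ?U"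
      using cylinder_in_openin_sigma_cube[OF _ _ B, of ?U] by blast
    then show ?thesis
      by (intro exI[of _ \<Phi>]) (auto simp: dist_real_def abs_minus_commute)
  qed
  then obtain \<Phi> where fin: "\<And>B. B \<in> small_sets k X \<Longrightarrow> finite (\<Phi> B)"
    and \<Phi>: "\<And>A B. B \<in> small_sets k X \<Longrightarrow> A \<in> small_sets k X \<Longrightarrow> A \<inter> \<Phi> B = B \<inter> \<Phi> B \<Longrightarrow>
      \<bar>g (char_fun X A) - g (char_fun X B)\<bar> < \<epsilon> / 2"
    by metis
  define N where "N B = char_fun X ` {A \<in> small_sets k X. A \<inter> \<Phi> B = B \<inter> \<Phi> B}" for B
  have "openin (sigma_cube k X) (N B)" if "B \<in> small_sets k X" for B
    using openin_sigma_cube_cylinder[OF fin[OF that]] that by (simp add: N_def small_sets_def)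
  moreover have "topspace (sigma_cube k X) \<subseteq> \<Union> (N ` small_sets k X)"
    by (auto simp: topspace_sigma_cube_image N_def)
  ultimately obtain \<F> where "finite \<F>" "\<F> \<subseteq> N ` small_sets k X"
      "topspace (sigma_cube k X) \<subseteq> \<Union> \<F>"
    using compact_space_sigma_cube[of k X] unfolding compact_space_alt
    by (elim allE[of _ "N ` small_sets k X"]) blast
  then obtain I where I: "finite I" "I \<subseteq> small_sets k X" "topspace (sigma_cube k X) \<subseteq> \<Union> (N ` I)"
    by (metis finite_subset_image)
  show "\<exists>\<Phi>. finite \<Phi> \<and> (\<forall>A\<in>small_sets k X. \<forall>B\<in>small_sets k X. A \<inter> \<Phi> = B \<inter> \<Phi> \<longrightarrow>
      \<bar>g (char_fun X A) - g (char_fun X B)\<bar> < \<epsilon>)"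
  proof (intro exI[of _ "\<Union> (\<Phi> ` I)"] conjI ballI impI)
    show "finite (\<Union> (\<Phi> ` I))"
      using I fin by blast
    fix A B assume A: "A \<in> small_sets k X" and B: "B \<in> small_sets k X"
      and eq: "A \<inter> \<Union> (\<Phi> ` I) = B \<inter> \<Union> (\<Phi> ` I)"
    have "char_fun X A \<in> \<Union> (N ` I)"
      using A I(3) by (auto simp: topspace_sigma_cube_image)
    then obtain C D where C: "C \<in> I" "D \<in> small_sets k X" "D \<inter> \<Phi> C = C \<inter> \<Phi> C"
        "char_fun X A = char_fun X D"
      by (auto simp: N_def)
    \<comment> \<open>A lies in the cylinder around C, and B agrees with A on \<Phi> C, so B lies in it as well.\<close>
    have "A = D"
      using C(2,4) A by (metis (no_types, lifting) mem_Collect_eq ones_char_fun small_sets_def)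
    have "A \<inter> \<Phi> C = C \<inter> \<Phi> C" "B \<inter> \<Phi> C = C \<inter> \<Phi> C"
      using C eq \<open>A = D\<close> by blast+
    moreover have "C \<in> small_sets k X"
      using C(1) I(2) by blast
    ultimately have "\<bar>g (char_fun X A) - g (char_fun X C)\<bar> < \<epsilon> / 2"
        "\<bar>g (char_fun X B) - g (char_fun X C)\<bar> < \<epsilon> / 2"
      using \<Phi> A B by blast+
    then show "\<bar>g (char_fun X A) - g (char_fun X B)\<bar> < \<epsilon>"
      by linarith
  qed
qed

lemma on_sigma_in_C_space:
  assumes h: "finitely_controlled k X h"
  shows "on_sigma k X h \<in> C_space (sigma_cube k X)"
proof -
  have "continuous_map (sigma_cube k X) euclideanreal (on_sigma k X h)"
    unfolding mtopology_is_euclidean[symmetric] Met_TC.continuous_map_to_metric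
  proof (intro ballI allI impI)
    fix p and \<epsilon> :: real assume p: "p \<in> topspace (sigma_cube k X)" and "\<epsilon> > 0"
    then obtain B where B: "B \<in> small_sets k X" "p = char_fun X B"
      by (auto simp: topspace_sigma_cube_image)
    obtain \<Phi> where \<Phi>: "finite \<Phi>" "\<And>A B. A \<in> small_sets k X \<Longrightarrow> B \<in> small_sets k X \<Longrightarrow>
        A \<inter> \<Phi> = B \<inter> \<Phi> \<Longrightarrow> \<bar>h A - h B\<bar> < \<epsilon>"
      using finitely_controlledE[OF h \<open>\<epsilon> > 0\<close>] by metis
    let ?N = "char_fun X ` {A \<in> small_sets k X. A \<inter> \<Phi> = B \<inter> \<Phi>}"
    have "openin (sigma_cube k X) ?N"
      using openin_sigma_cube_cylinder[OF \<Phi>(1)] B(1) by (simp add: small_sets_def)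
    moreover have "p \<in> ?N"
      using B by blast
    moreover have "on_sigma k X h q \<in> Met_TC.mball (on_sigma k X h p) \<epsilon>" if q: "q \<in> ?N" for q
    proof -
      obtain A where "A \<in> small_sets k X" "A \<inter> \<Phi> = B \<inter> \<Phi>" "q = char_fun X A"
        using q by blast
      moreover from this have "\<bar>h B - h A\<bar> < \<epsilon>"
        using \<Phi>(2)[of B A] B(1) by simp
      ultimately show ?thesis
        using B by (simp add: dist_real_def)
    qed
    ultimately show "\<exists>U. openin (sigma_cube k X) U \<and> p \<in> U \<and>
        (\<forall>q\<in>U. on_sigma k X h q \<in> Met_TC.mball (on_sigma k X h p) \<epsilon>)"
      by blast
  qed
  then show ?thesis
    by (simp add: C_space_compact[OF compact_space_sigma_cube] on_sigma_def)
qed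

lemma finitely_controlled_affine:
  assumes "finitely_controlled k X g" "finitely_controlled k X h"
  shows "finitely_controlled k X (\<lambda>A. a * g A + h A)"
proof (rule finitely_controlledI)
  fix \<epsilon> :: real assume "\<epsilon> > 0"
  define \<delta> where "\<delta> = \<epsilon> / (\<bar>a\<bar> + 1)"
  have "\<delta> > 0" and \<delta>: "(\<bar>a\<bar> + 1) * \<delta> = \<epsilon>"
    using \<open>\<epsilon> > 0\<close> by (auto simp: \<delta>_def field_simps intro!: divide_pos_pos)
  obtain \<Phi> where \<Phi>: "finite \<Phi>" "\<And>A B. A \<in> small_sets k X \<Longrightarrow> B \<in> small_sets k X \<Longrightarrow>
      A \<inter> \<Phi> = B \<inter> \<Phi> \<Longrightarrow> \<bar>g A - g B\<bar> < \<delta>"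
    using finitely_controlledE[OF assms(1) \<open>\<delta> > 0\<close>] by metis
  obtain \<Psi> where \<Psi>: "finite \<Psi>" "\<And>A B. A \<in> small_sets k X \<Longrightarrow> B \<in> small_sets k X \<Longrightarrow>
      A \<inter> \<Psi> = B \<inter> \<Psi> \<Longrightarrow> \<bar>h A - h B\<bar> < \<delta>"
    using finitely_controlledE[OF assms(2) \<open>\<delta> > 0\<close>] by metis
  show "\<exists>\<Phi>. finite \<Phi> \<and> (\<forall>A\<in>small_sets k X. \<forall>B\<in>small_sets k X.
      A \<inter> \<Phi> = B \<inter> \<Phi> \<longrightarrow> \<bar>(a * g A + h A) - (a * g B + h B)\<bar> < \<epsilon>)"
  proof (intro exI[of _ "\<Phi> \<union> \<Psi>"] conjI ballI impI)
    fix A B assume *: "A \<in> small_sets k X" "B \<in> small_sets k X" "A \<inter> (\<Phi> \<union> \<Psi>) = B \<inter> (\<Phi> \<union> \<Psi>)"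
    then have "A \<inter> \<Phi> = B \<inter> \<Phi>" "A \<inter> \<Psi> = B \<inter> \<Psi>" by blast+
    then have "\<bar>g A - g B\<bar> < \<delta>" "\<bar>h A - h B\<bar> < \<delta>"
      using \<Phi>(2) \<Psi>(2) *(1,2) by simp_all
    moreover have "\<bar>(a * g A + h A) - (a * g B + h B)\<bar> \<le> \<bar>a\<bar> * \<bar>g A - g B\<bar> + \<bar>h A - h B\<bar>"
      by (simp flip: abs_mult add: algebra_simps)
    moreover have "\<bar>a\<bar> * \<bar>g A - g B\<bar> \<le> \<bar>a\<bar> * \<delta>"
      using calculation(1) by (intro mult_left_mono) auto
    ultimately show "\<bar>(a * g A + h A) - (a * g B + h B)\<bar> < \<epsilon>"
      using \<delta> by (simp add: algebra_simps)
  qed (use \<Phi> \<Psi> in auto)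
qed

lemma topspace_sigma_cube_nonempty: "topspace (sigma_cube k X) \<noteq> {}"
proof -
  have "{} \<in> small_sets k X"
    by (simp add: small_sets_def)
  then show ?thesis
    by (auto simp: topspace_sigma_cube_image)
qed

lemma abs_le_C_norm:
  assumes g: "g \<in> C_space (sigma_cube k X)" and p: "p \<in> topspace (sigma_cube k X)"
  shows "\<bar>g p\<bar> \<le> C_norm (sigma_cube k X) g"
proof -
  have "bounded (g ` topspace (sigma_cube k X))"
    using g by (auto simp: C_space_def)
  then have "bdd_above ((\<lambda>p. \<bar>g p\<bar>) ` topspace (sigma_cube k X))"
    by (auto simp: bounded_iff bdd_above_def)
  then show ?thesis
    unfolding C_norm_eq_SUP[OF g topspace_sigma_cube_nonempty] by (rule cSUP_upper[OF p])
qed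

lemma C_norm_le:
  assumes "g \<in> C_space (sigma_cube k X)"
    and "\<And>A. A \<in> small_sets k X \<Longrightarrow> \<bar>g (char_fun X A)\<bar> \<le> M"
  shows "C_norm (sigma_cube k X) g \<le> M"
proof -
  have "(SUP p\<in>topspace (sigma_cube k X). \<bar>g p\<bar>) \<le> M"
    using topspace_sigma_cube_nonempty
    by (rule cSUP_least) (use assms(2) in \<open>auto simp: topspace_sigma_cube_image\<close>)
  then show ?thesis
    by (simp add: C_norm_eq_SUP[OF assms(1) topspace_sigma_cube_nonempty])
qed

lemma C_norm_nonneg:
  assumes "g \<in> C_space (sigma_cube k X)"
  shows "0 \<le> C_norm (sigma_cube k X) g"
  using topspace_sigma_cube_nonempty abs_le_C_norm[OF assms] abs_ge_zero order_trans by blast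

lemma finitely_controlled_const: "finitely_controlled k X (\<lambda>_. a)"
  by (rule finitely_controlledI) (auto intro: exI[of _ "{}"])

lemma char_fun_in_topspace: "A \<in> small_sets k X \<Longrightarrow> char_fun X A \<in> topspace (sigma_cube k X)"
  by (simp add: topspace_sigma_cube_image)

lemma small_sets_mono: "k \<le> l \<Longrightarrow> small_sets k X \<subseteq> small_sets l X"
  by (auto simp: small_sets_def)

section \<open>An extension operator of small norm\<close>

text \<open>
  When e is injective on B, these are the first k elements of B in the order that e induces.
\<close>

definition first_elems :: "nat \<Rightarrow> ('a \<Rightarrow> nat) \<Rightarrow> 'a set \<Rightarrow> 'a set" where
  "first_elems k e B = {x \<in> B. card {y \<in> B. e y < e x} < k}"

lemma first_elems_subset: "first_elems k e B \<subseteq> B"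
  by (auto simp: first_elems_def)

lemma first_elems_eq:
  assumes "finite B" "card B \<le> k"
  shows "first_elems k e B = B"
proof -
  have "card {y \<in> B. e y < e x} < k" if "x \<in> B" for x
  proof -
    have "{y \<in> B. e y < e x} \<subset> B" using that by auto
    then have "card {y \<in> B. e y < e x} < card B"
      by (rule psubset_card_mono[OF assms(1)])
    then show ?thesis
      using assms(2) by linarith
  qed
  then show ?thesis by (auto simp: first_elems_def)
qed

lemma card_first_elems_le:
  assumes "finite B" "inj_on e B"
  shows "card (first_elems k e B) \<le> k"
proof (cases "first_elems k e B = {}")
  case False
  let ?F = "first_elems k e B"
  have fin: "finite ?F"
    using assms(1) first_elems_subset finite_subset by metis
  then have "Max (e ` ?F) \<in> e ` ?F"
    using False by (intro Max_in) auto
  then obtain x where x: "x \<in> ?F" "e x = Max (e ` ?F)"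
    by auto
  have "?F - {x} \<subseteq> {y \<in> B. e y < e x}"
  proof
    fix y assume y: "y \<in> ?F - {x}"
    then have "y \<in> B" "x \<in> B" using x(1) first_elems_subset by fastforce+
    have "e y \<noteq> e x" using \<open>y \<in> B\<close> \<open>x \<in> B\<close> assms(2) y by (auto dest: inj_onD)
    moreover have "e y \<le> e x"
      unfolding x(2) using y fin by (intro Max_ge) auto
    ultimately show "y \<in> {y \<in> B. e y < e x}"
      using \<open>y \<in> B\<close> by simp
  qed
  then have "card (?F - {x}) \<le> card {y \<in> B. e y < e x}"
    using assms(1) by (intro card_mono) auto
  also have "\<dots> < k"
    using x(1) by (simp add: first_elems_def)
  finally show ?thesis
    using x(1) fin by simp
qed simp

text \<open>
  What the construction uses of the well-order of X in type \<omega>_1: a strict linear order all of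
  whose initial segments are countable.  The set below c consists of the predecessors of c.
\<close>

locale countable_initial_segments =
  fixes X :: "'a set" and below :: "'a \<Rightarrow> 'a set"
  assumes countable_below: "c \<in> X \<Longrightarrow> countable (below c)"
    and below_irrefl: "c \<notin> below c"
    and below_trans: "d \<in> below c \<Longrightarrow> below d \<subseteq> below c"
    and below_linear: "c \<in> X \<Longrightarrow> d \<in> X \<Longrightarrow> c \<noteq> d \<Longrightarrow> c \<in> below d \<or> d \<in> below c"
begin

lemma finite_has_top:
  assumes "finite A" "A \<noteq> {}" "A \<subseteq> X"
  shows "\<exists>c\<in>A. A - {c} \<subseteq> below c"
  using assms
proof (induction rule: finite_ne_induct)
  case (singleton x)
  then show ?case by simp
next
  case (insert x F)
  then obtain c where c: "c \<in> F" "F - {c} \<subseteq> below c"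
    by auto
  have "c \<noteq> x" using c(1) insert by auto
  then consider "x \<in> below c" | "c \<in> below x"
    using below_linear[of c x] insert.prems c(1) by auto
  then show ?case
  proof cases
    case 1
    then show ?thesis using c by (intro bexI[of _ c]) auto
  next
    case 2
    then have "F \<subseteq> below x" using c below_trans[OF 2] by blast
    then show ?thesis by (intro bexI[of _ x]) auto
  qed
qed

text \<open>
  Tailored to the sum extend below: a new greatest element c lies below no old element, so the summands
  of the old elements stay as they are and only the summand of c is added.
\<close>

lemma finite_induct_top [consumes 2, case_names empty insert]:
  assumes "finite A" "A \<subseteq> X"
    and "Q {}"
    and step: "\<And>c A. finite A \<Longrightarrow> A \<subseteq> X \<Longrightarrow> c \<in> X \<Longrightarrow> A \<subseteq> below c \<Longrightarrow> Q A \<Longrightarrow> Q (insert c A)"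
  shows "Q A"
  using assms(1,2)
proof (induction "card A" arbitrary: A)
  case 0
  then show ?case using assms(3) by simp
next
  case (Suc j)
  then obtain c where c: "c \<in> A" "A - {c} \<subseteq> below c"
    using finite_has_top[of A] by force
  have "Q (A - {c})"
    using Suc c(1) by (intro Suc.hyps(1)) auto
  then have "Q (insert c (A - {c}))"
    using Suc.prems c by (intro step) auto
  then show ?case using c(1) by (simp add: insert_absorb)
qed

text \<open>
  The heart of the construction.  As below c is countable, it can be enumerated, and A \<mapsto>
  first_below k c A, the first k elements of A \<inter> below c in that enumeration, induces a continuous
  retraction onto the sets of at most k elements below c.  Continuity holds because deciding whether
  x is among the first k elements involves only the finitely many points enumerated no later than x.

  Without truncation the sum in extend telescopes to h A.  Truncating makes every argument of h
  have at most k + 1 elements, which is what allows h to be defined on such sets only.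
\<close>

definition first_below :: "nat \<Rightarrow> 'a \<Rightarrow> 'a set \<Rightarrow> 'a set" where
  "first_below k c A = first_elems k (to_nat_on (below c)) (A \<inter> below c)"

definition extend :: "nat \<Rightarrow> ('a set \<Rightarrow> real) \<Rightarrow> 'a set \<Rightarrow> real" where
  "extend k h A = h {} + (\<Sum>c\<in>A. h (insert c (first_below k c A)) - h (first_below k c A))"

lemma first_below_subset: "first_below k c A \<subseteq> A \<inter> below c"
  unfolding first_below_def by (rule first_elems_subset)

lemma first_below_in_small_sets:
  assumes "finite A" "A \<subseteq> X" "c \<in> X"
  shows "first_below k c A \<in> small_sets k X"
proof -
  have "inj_on (to_nat_on (below c)) (A \<inter> below c)"
    using countable_below[OF assms(3)] by (meson inf_le2 inj_on_subset inj_on_to_nat_on)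
  then have "card (first_below k c A) \<le> k"
    using card_first_elems_le assms(1) unfolding first_below_def by blast
  moreover have "finite (first_below k c A)" "first_below k c A \<subseteq> X"
    using first_below_subset[of k c A] assms finite_subset by auto
  ultimately show ?thesis
    by (simp add: small_sets_def)
qed

lemma small_sets_Suc:
  assumes "D \<in> small_sets k X" "c \<in> X"
  shows "D \<in> small_sets (Suc k) X" "insert c D \<in> small_sets (Suc k) X"
  using assms card_insert_le_m1[of "Suc k" D c] by (auto simp: small_sets_def)

lemma extend_insert_top:
  assumes A: "finite A" "A \<subseteq> below c"
  shows "extend k h (insert c A) = extend k h A +
    (h (insert c (first_elems k (to_nat_on (below c)) A)) -
     h (first_elems k (to_nat_on (below c)) A))"
proof -
  have "c \<notin> A" using A(2) below_irrefl by auto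
  have same: "first_below k d (insert c A) = first_below k d A" if "d \<in> A" for d
  proof -
    have "c \<notin> below d" using that A(2) below_trans below_irrefl by blast
    then have "insert c A \<inter> below d = A \<inter> below d" by blast
    then show ?thesis by (simp add: first_below_def)
  qed
  have "insert c A \<inter> below c = A"
    using A(2) below_irrefl by blast
  then have "first_below k c (insert c A) = first_elems k (to_nat_on (below c)) A"
    by (simp add: first_below_def)
  then show ?thesis
    using \<open>c \<notin> A\<close> A(1) by (simp add: extend_def same)
qed

text \<open>
  While the predecessors of c in A number at most k, truncation does nothing and the sum telescopes.
\<close>

lemma extend_eq:
  assumes "finite A" "A \<subseteq> X" "card A \<le> Suc k"
  shows "extend k h A = h A"
  using assms
proof (induction rule: finite_induct_top)
  case empty
  then show ?case by (simp add: extend_def)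
next
  case (insert c A)
  have "c \<notin> A" using insert.hyps below_irrefl by auto
  then have "card A \<le> k" using insert by simp
  then show ?case
    using insert by (simp add: extend_insert_top first_elems_eq)
qed

text \<open>
  The first k + 1 elements of A contribute a single value of h, by telescoping; each later element
  contributes a difference of two values.
\<close>

lemma abs_extend_le:
  assumes "finite A" "A \<subseteq> X" and M: "\<And>D. D \<in> small_sets (Suc k) X \<Longrightarrow> \<bar>h D\<bar> \<le> M"
  shows "\<bar>extend k h A\<bar> \<le> (2 * real (card A - Suc k) + 1) * M"
  using assms(1,2)
proof (induction rule: finite_induct_top)
  case empty
  have "{} \<in> small_sets (Suc k) X" by (simp add: small_sets_def)
  then show ?case using M by (simp add: extend_def)
next
  case (insert c A)
  have "c \<notin> A" using insert.hyps below_irrefl by auto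
  show ?case
  proof (cases "card (insert c A) \<le> Suc k")
    case True
    have "insert c A \<in> small_sets (Suc k) X"
      using True insert by (simp add: small_sets_def)
    then show ?thesis
      using extend_eq[of "insert c A" k h] True M insert.hyps by simp
  next
    case False
    then have eq: "real (card (insert c A) - Suc k) = real (card A - Suc k) + 1"
      using \<open>c \<notin> A\<close> insert.hyps by simp
    let ?D = "first_elems k (to_nat_on (below c)) A"
    have "?D \<in> small_sets k X"
      using first_below_in_small_sets[of A c k] insert.hyps by (simp add: first_below_def Int_absorb2)
    then have "\<bar>h ?D\<bar> \<le> M" "\<bar>h (insert c ?D)\<bar> \<le> M"
      using small_sets_Suc M insert.hyps by blast+
    then show ?thesis
      using insert.IH unfolding eq by (simp add: extend_insert_top insert.hyps algebra_simps)
  qed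
qed

lemma extend_affine:
  assumes A: "finite A" "A \<subseteq> X"
    and "\<And>D. D \<in> small_sets (Suc k) X \<Longrightarrow> h D = a * f D + g D"
  shows "extend k h A = a * extend k f A + extend k g A"
proof -
  have "h (insert c (first_below k c A)) - h (first_below k c A) =
      a * (f (insert c (first_below k c A)) - f (first_below k c A)) +
      (g (insert c (first_below k c A)) - g (first_below k c A))" if "c \<in> A" for c
  proof -
    have "c \<in> X" using that A by auto
    then have "first_below k c A \<in> small_sets (Suc k) X" "insert c (first_below k c A) \<in> small_sets (Suc k) X"
      using first_below_in_small_sets[OF A] small_sets_Suc by blast+
    then show ?thesis
      using assms(3) by (simp add: algebra_simps)
  qed
  then have "(\<Sum>c\<in>A. h (insert c (first_below k c A)) - h (first_below k c A)) =
      (\<Sum>c\<in>A. a * (f (insert c (first_below k c A)) - f (first_below k c A)) +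
        (g (insert c (first_below k c A)) - g (first_below k c A)))"
    by (rule sum.cong[OF refl])
  moreover have "h {} = a * f {} + g {}"
    by (rule assms(3)) (simp add: small_sets_def)
  ultimately show ?thesis
    by (simp add: extend_def sum.distrib distrib_left flip: sum_distrib_left)
qed

lemma finite_segment:
  assumes "c \<in> X"
  shows "finite {y \<in> below c. to_nat_on (below c) y \<le> j}"
proof -
  have "inj_on (to_nat_on (below c)) {y \<in> below c. to_nat_on (below c) y \<le> j}"
    using countable_below[OF assms] by (auto intro: inj_on_subset[OF inj_on_to_nat_on])
  then show ?thesis
    by (rule inj_on_finite[of _ _ "{..j}"]) auto
qed

lemma first_below_determined:
  assumes "c \<in> X" "finite \<Phi>"
  obtains \<Psi> where "finite \<Psi>"
    "\<And>A B. A \<inter> \<Psi> = B \<inter> \<Psi> \<Longrightarrow> first_below k c A \<inter> \<Phi> = first_below k c B \<inter> \<Phi>"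
proof
  let ?e = "to_nat_on (below c)"
  let ?\<Psi> = "\<Union>x\<in>\<Phi>. {y \<in> below c. ?e y \<le> ?e x}"
  show "finite ?\<Psi>"
    using assms finite_segment by blast
  fix A B assume eq: "A \<inter> ?\<Psi> = B \<inter> ?\<Psi>"
  have "x \<in> first_below k c A \<longleftrightarrow> x \<in> first_below k c B" if "x \<in> \<Phi>" for x
  proof -
    have "y \<in> A \<longleftrightarrow> y \<in> B" if "y \<in> below c" "?e y \<le> ?e x" for y
      using eq that \<open>x \<in> \<Phi>\<close> by blast
    then have "x \<in> A \<inter> below c \<longleftrightarrow> x \<in> B \<inter> below c"
      and "{y \<in> A \<inter> below c. ?e y < ?e x} = {y \<in> B \<inter> below c. ?e y < ?e x}"
      by auto
    moreover from this(1) have "x \<in> first_below k c A \<longleftrightarrow>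
        x \<in> B \<inter> below c \<and> card {y \<in> A \<inter> below c. ?e y < ?e x} < k"
      by (simp add: first_below_def first_elems_def del: Int_iff)
    ultimately show ?thesis
      by (simp add: first_below_def first_elems_def del: Int_iff)
  qed
  then show "first_below k c A \<inter> \<Phi> = first_below k c B \<inter> \<Phi>" by blast
qed

text \<open>
  Let \<Phi> control h up to \<delta>.  For c outside \<Phi> the summand of c is a difference of values
  of h at two sets that agree on \<Phi>, so it is small whatever A is.  For each of the finitely many c
  in \<Phi> the summand depends, up to an error, only on the trace of the truncated set on \<Phi>, and this
  trace is determined by finitely many coordinates of A.
\<close>

lemma finitely_controlled_extend:
  assumes h: "finitely_controlled (Suc k) X h"
  shows "finitely_controlled n X (extend k h)"
proof (rule finitely_controlledI)
  fix \<epsilon> :: real assume "\<epsilon> > 0"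
  \<comment> \<open>At most n indices outside \<Phi> for each of A and B give errors \<delta>; at most n common indices
      in \<Phi> give errors 2 \<delta>.\<close>
  define \<delta> where "\<delta> = \<epsilon> / (4 * real n + 1)"
  have "\<delta> > 0" and \<delta>: "4 * (real n * \<delta>) < \<epsilon>"
    using \<open>\<epsilon> > 0\<close> by (auto simp: \<delta>_def field_simps)
  obtain \<Phi> where \<Phi>: "finite \<Phi>" "\<And>A B. A \<in> small_sets (Suc k) X \<Longrightarrow>
      B \<in> small_sets (Suc k) X \<Longrightarrow> A \<inter> \<Phi> = B \<inter> \<Phi> \<Longrightarrow> \<bar>h A - h B\<bar> < \<delta>"
    using finitely_controlledE[OF h \<open>\<delta> > 0\<close>] by metis
  have "\<exists>\<Psi>. finite \<Psi> \<and> (\<forall>A B. A \<inter> \<Psi> = B \<inter> \<Psi> \<longrightarrow> first_below k c A \<inter> \<Phi> = first_below k c B \<inter> \<Phi>)"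
    if "c \<in> \<Phi> \<inter> X" for c
    using first_below_determined[of c \<Phi> k] \<Phi>(1) that by (metis IntD2)
  then obtain \<Psi> where \<Psi>: "\<And>c. c \<in> \<Phi> \<inter> X \<Longrightarrow> finite (\<Psi> c)"
      "\<And>c A B. c \<in> \<Phi> \<inter> X \<Longrightarrow> A \<inter> \<Psi> c = B \<inter> \<Psi> c \<Longrightarrow> first_below k c A \<inter> \<Phi> = first_below k c B \<inter> \<Phi>"
    by metis
  define \<Delta> where "\<Delta> A c = h (insert c (first_below k c A)) - h (first_below k c A)" for A c
  have small: "first_below k c A \<in> small_sets (Suc k) X" "insert c (first_below k c A) \<in> small_sets (Suc k) X"
    if "A \<in> small_sets n X" "c \<in> X" for A c
    using first_below_in_small_sets[of A c k] small_sets_Suc that by (auto simp: small_sets_def)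
  have far: "\<bar>\<Sum>c\<in>A - \<Phi>. \<Delta> A c\<bar> \<le> real n * \<delta>" if A: "A \<in> small_sets n X" for A
  proof -
    have "\<bar>\<Delta> A c\<bar> \<le> \<delta>" if "c \<in> A - \<Phi>" for c
      unfolding \<Delta>_def using that small[OF A, of c] A
      by (intro less_imp_le \<Phi>(2)) (auto simp: small_sets_def)
    then have "\<bar>\<Sum>c\<in>A - \<Phi>. \<Delta> A c\<bar> \<le> real (card (A - \<Phi>)) * \<delta>"
      by (intro order_trans[OF sum_abs] sum_bounded_above)
    also have "\<dots> \<le> real n * \<delta>"
      using A \<open>\<delta> > 0\<close> card_Diff1_le card_mono[of A "A - \<Phi>"]
      by (intro mult_right_mono) (auto simp: small_sets_def)
    finally show ?thesis .
  qed
  show "\<exists>\<Phi>. finite \<Phi> \<and> (\<forall>A\<in>small_sets n X. \<forall>B\<in>small_sets n X.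
      A \<inter> \<Phi> = B \<inter> \<Phi> \<longrightarrow> \<bar>extend k h A - extend k h B\<bar> < \<epsilon>)"
  proof (intro exI[of _ "\<Phi> \<union> (\<Union>c\<in>\<Phi> \<inter> X. \<Psi> c)"] conjI ballI impI)
    show "finite (\<Phi> \<union> (\<Union>c\<in>\<Phi> \<inter> X. \<Psi> c))"
      using \<Phi>(1) \<Psi>(1) by blast
    fix A B assume A: "A \<in> small_sets n X" and B: "B \<in> small_sets n X"
      and eq: "A \<inter> (\<Phi> \<union> (\<Union>c\<in>\<Phi> \<inter> X. \<Psi> c)) = B \<inter> (\<Phi> \<union> (\<Union>c\<in>\<Phi> \<inter> X. \<Psi> c))"
    have AB: "B \<inter> \<Phi> = A \<inter> \<Phi>" using eq by blast
    have "\<bar>\<Delta> A c - \<Delta> B c\<bar> \<le> 2 * \<delta>" if c: "c \<in> A \<inter> \<Phi>" for c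
    proof -
      have "c \<in> X" using c A by (auto simp: small_sets_def)
      then have "A \<inter> \<Psi> c = B \<inter> \<Psi> c" using eq c by blast
      then have "first_below k c A \<inter> \<Phi> = first_below k c B \<inter> \<Phi>"
        using \<Psi>(2) c \<open>c \<in> X\<close> by blast
      then have "\<bar>h (first_below k c A) - h (first_below k c B)\<bar> < \<delta>"
        "\<bar>h (insert c (first_below k c A)) - h (insert c (first_below k c B))\<bar> < \<delta>"
        using small[OF A \<open>c \<in> X\<close>] small[OF B \<open>c \<in> X\<close>] c by (auto intro!: \<Phi>(2))
      then show ?thesis by (simp add: \<Delta>_def)
    qed
    then have "\<bar>\<Sum>c\<in>A \<inter> \<Phi>. \<Delta> A c - \<Delta> B c\<bar> \<le> real (card (A \<inter> \<Phi>)) * (2 * \<delta>)"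
      by (intro order_trans[OF sum_abs] sum_bounded_above)
    also have "\<dots> \<le> real n * (2 * \<delta>)"
      using A \<open>\<delta> > 0\<close> card_mono[of A "A \<inter> \<Phi>"]
      by (intro mult_right_mono) (auto simp: small_sets_def)
    finally have near: "\<bar>\<Sum>c\<in>A \<inter> \<Phi>. \<Delta> A c - \<Delta> B c\<bar> \<le> 2 * (real n * \<delta>)" by simp
    have split: "extend k h D = h {} + ((\<Sum>c\<in>D \<inter> \<Phi>. \<Delta> D c) + (\<Sum>c\<in>D - \<Phi>. \<Delta> D c))"
      if "D \<in> small_sets n X" for D
      using that by (simp add: extend_def \<Delta>_def small_sets_def sum.Int_Diff[of D _ \<Phi>])
    have "extend k h A - extend k h B =
        (\<Sum>c\<in>A \<inter> \<Phi>. \<Delta> A c - \<Delta> B c) + (\<Sum>c\<in>A - \<Phi>. \<Delta> A c) - (\<Sum>c\<in>B - \<Phi>. \<Delta> B c)"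
      unfolding split[OF A] split[OF B] AB by (simp add: sum_subtractf)
    then show "\<bar>extend k h A - extend k h B\<bar> < \<epsilon>"
      using near far[OF A] far[OF B] \<delta> by linarith
  qed
qed

end

text \<open>
  With k = m - 1 the operator h \<mapsto> extend k h maps C(\<sigma>_m) to C(\<sigma>_n) and is the
  identity on sets of at most m elements.  A set of n elements gives the norm 1 + 2(n - m).
\<close>

lemma (in countable_initial_segments) eta_sigma_cube_le:
  assumes "1 \<le> m" "m \<le> n"
  shows "eta (sigma_cube m X) (sigma_cube n X) \<le> ereal (2 * real n - 2 * real m + 1)"
proof -
  obtain k where m: "m = Suc k"
    using assms(1) by (cases m) auto
  let ?L = "sigma_cube m X" and ?K = "sigma_cube n X"
  define N where "N = 2 * real n - 2 * real m + 1"
  define T where "T f = on_sigma n X (extend k (\<lambda>A. f (char_fun X A)))" for f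
  have T_in: "T f \<in> C_space ?K" if "f \<in> C_space ?L" for f
    using on_sigma_in_C_space finitely_controlled_extend finitely_controlled_of_C_space that
    unfolding T_def m by blast
  have T_char: "T f (char_fun X A) = extend k (\<lambda>A. f (char_fun X A)) A"
    if "A \<in> small_sets n X" for f A
    using that by (simp add: T_def)
  have norm: "C_norm ?K (T f) \<le> N * C_norm ?L f" if f: "f \<in> C_space ?L" for f
  proof (rule C_norm_le[OF T_in[OF f]])
    fix A assume A: "A \<in> small_sets n X"
    have "\<bar>extend k (\<lambda>A. f (char_fun X A)) A\<bar> \<le> (2 * real (card A - Suc k) + 1) * C_norm ?L f"
      using A by (intro abs_extend_le abs_le_C_norm[OF f])
        (simp_all add: small_sets_def char_fun_in_topspace[unfolded small_sets_def] m)
    also have "\<dots> \<le> N * C_norm ?L f"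
      using A assms(2) C_norm_nonneg[OF f]
      by (intro mult_right_mono) (auto simp: N_def m small_sets_def)
    finally show "\<bar>T f (char_fun X A)\<bar> \<le> N * C_norm ?L f"
      by (simp add: T_char[OF A])
  qed
  have "bounded_operator ?L ?K T"
    unfolding bounded_operator_def
  proof (intro conjI ballI allI)
    show "T \<in> C_space ?L \<rightarrow> C_space ?K"
      using T_in by blast
    show "\<exists>B. \<forall>f\<in>C_space ?L. C_norm ?K (T f) \<le> B * C_norm ?L f"
      using norm by blast
  next
    fix f g p assume "p \<in> topspace ?K"
    then obtain A where A: "A \<in> small_sets n X" "p = char_fun X A"
      by (auto simp: topspace_sigma_cube_image)
    have "extend k (\<lambda>A. restrict (\<lambda>y. f y + g y) (topspace ?L) (char_fun X A)) A =
        1 * extend k (\<lambda>A. f (char_fun X A)) A + extend k (\<lambda>A. g (char_fun X A)) A"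
      using A(1) by (intro extend_affine) (simp_all add: char_fun_in_topspace m, simp_all add: small_sets_def)
    then show "T (restrict (\<lambda>y. f y + g y) (topspace ?L)) p = T f p + T g p"
      by (simp add: A T_char)
  next
    fix c f p assume "p \<in> topspace ?K"
    then obtain A where A: "A \<in> small_sets n X" "p = char_fun X A"
      by (auto simp: topspace_sigma_cube_image)
    have "extend k (\<lambda>A. restrict (\<lambda>y. c * f y) (topspace ?L) (char_fun X A)) A =
        c * extend k (\<lambda>A. f (char_fun X A)) A + extend k (\<lambda>_. 0) A"
      using A(1) by (intro extend_affine) (simp_all add: char_fun_in_topspace m, simp_all add: small_sets_def)
    then show "T (restrict (\<lambda>y. c * f y) (topspace ?L)) p = c * T f p"
      by (simp add: A T_char extend_def)
  qed
  moreover have "T f p = f p" if "p \<in> topspace ?L" for f p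
  proof -
    obtain A where A: "A \<in> small_sets m X" "p = char_fun X A"
      using \<open>p \<in> topspace ?L\<close> by (auto simp: topspace_sigma_cube_image)
    then have "A \<in> small_sets n X"
      using small_sets_mono[OF assms(2)] by blast
    then show ?thesis
      using A by (simp add: T_char extend_eq small_sets_def m)
  qed
  ultimately have "extension_operator ?L ?K T"
    by (simp add: extension_operator_def)
  moreover have "op_norm ?L ?K T \<le> N"
    unfolding op_norm_def
  proof (rule cSUP_least)
    have "on_sigma m X (\<lambda>_. 0) \<in> C_space ?L"
      by (intro on_sigma_in_C_space finitely_controlled_const)
    moreover from this have "C_norm ?L (on_sigma m X (\<lambda>_. 0)) \<le> 1"
      by (rule C_norm_le) simp
    ultimately show "{f \<in> C_space ?L. C_norm ?L f \<le> 1} \<noteq> {}"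
      by blast
    fix f assume f: "f \<in> {f \<in> C_space ?L. C_norm ?L f \<le> 1}"
    have "N * C_norm ?L f \<le> N * 1"
      using f assms(2) by (intro mult_left_mono) (auto simp: N_def)
    then show "C_norm ?K (T f) \<le> N"
      using norm[of f] f by simp
  qed
  ultimately show ?thesis
    unfolding eta_def N_def by (intro INF_lower2[of T]) auto
qed

section \<open>Every extension operator has large norm\<close>

text \<open>
  On \<sigma>_m this is the characteristic function of the clopen set of all A that include D.  When D has
  exactly m elements, that set is the single point D.
\<close>

definition superset_ind :: "'a set \<Rightarrow> 'a set \<Rightarrow> real" where
  "superset_ind D A = (if D \<subseteq> A then 1 else 0)"

lemma finitely_controlled_superset_ind:
  assumes "finite D"
  shows "finitely_controlled k X (superset_ind D)"
proof (rule finitely_controlledI)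
  fix \<epsilon> :: real assume "\<epsilon> > 0"
  have eq: "superset_ind D A = superset_ind D B" if "A \<inter> D = B \<inter> D" for A B
  proof -
    have "D \<subseteq> A \<longleftrightarrow> D \<subseteq> B"
      using that by blast
    then show ?thesis by (simp add: superset_ind_def)
  qed
  show "\<exists>\<Phi>. finite \<Phi> \<and> (\<forall>A\<in>small_sets k X. \<forall>B\<in>small_sets k X.
      A \<inter> \<Phi> = B \<inter> \<Phi> \<longrightarrow> \<bar>superset_ind D A - superset_ind D B\<bar> < \<epsilon>)"
  proof (intro exI[of _ D] conjI ballI impI)
    fix A B assume "A \<inter> D = B \<inter> D"
    then show "\<bar>superset_ind D A - superset_ind D B\<bar> < \<epsilon>"
      using eq[of A B] \<open>\<epsilon> > 0\<close> by simp
  qed (fact assms)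
qed

lemma bounded_operator_affine:
  assumes T: "bounded_operator (sigma_cube m X) K T"
    and g: "finitely_controlled m X g" and h: "finitely_controlled m X h"
    and p: "p \<in> topspace K"
  shows "T (on_sigma m X (\<lambda>A. a * g A + h A)) p =
    a * T (on_sigma m X g) p + T (on_sigma m X h) p"
proof -
  let ?L = "sigma_cube m X"
  have "finitely_controlled m X (\<lambda>A. a * g A)"
    using finitely_controlled_affine[OF g finitely_controlled_const, of a 0] by simp
  then have in_C: "on_sigma m X g \<in> C_space ?L" "on_sigma m X h \<in> C_space ?L"
      "on_sigma m X (\<lambda>A. a * g A) \<in> C_space ?L"
    using g h by (simp_all add: on_sigma_in_C_space)
  have eq: "on_sigma m X (\<lambda>A. a * g A + h A) =
      restrict (\<lambda>y. on_sigma m X (\<lambda>A. a * g A) y + on_sigma m X h y) (topspace ?L)"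
    and eq2: "on_sigma m X (\<lambda>A. a * g A) = restrict (\<lambda>y. a * on_sigma m X g y) (topspace ?L)"
    by (auto simp: on_sigma_def fun_eq_iff)
  have "T (restrict (\<lambda>y. on_sigma m X (\<lambda>A. a * g A) y + on_sigma m X h y) (topspace ?L)) p =
      T (on_sigma m X (\<lambda>A. a * g A)) p + T (on_sigma m X h) p"
    and "T (restrict (\<lambda>y. a * on_sigma m X g y) (topspace ?L)) p = a * T (on_sigma m X g) p"
    using T in_C p unfolding bounded_operator_def by blast+
  then show ?thesis
    by (simp only: eq eq2)
qed

lemma bounded_operator_sum:
  assumes T: "bounded_operator (sigma_cube m X) K T"
    and g: "\<And>x. x \<in> R \<Longrightarrow> finitely_controlled m X (g x)" and h: "finitely_controlled m X h"
    and p: "p \<in> topspace K" and R: "finite R"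
  shows "finitely_controlled m X (\<lambda>A. a * (\<Sum>x\<in>R. g x A) + h A) \<and>
    T (on_sigma m X (\<lambda>A. a * (\<Sum>x\<in>R. g x A) + h A)) p =
    a * (\<Sum>x\<in>R. T (on_sigma m X (g x)) p) + T (on_sigma m X h) p"
  using R g
proof (induction R rule: finite_induct)
  case empty
  then show ?case using h by simp
next
  case (insert x R)
  let ?s = "\<lambda>A. a * (\<Sum>x\<in>R. g x A) + h A"
  have IH: "finitely_controlled m X ?s" "T (on_sigma m X ?s) p =
      a * (\<Sum>x\<in>R. T (on_sigma m X (g x)) p) + T (on_sigma m X h) p"
    using insert by simp_all
  have gx: "finitely_controlled m X (g x)"
    using insert.prems by simp
  have eq: "(\<lambda>A. a * (\<Sum>x\<in>insert x R. g x A) + h A) = (\<lambda>A. a * g x A + ?s A)"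
    using insert.hyps by (simp add: fun_eq_iff algebra_simps)
  show ?case
    unfolding eq bounded_operator_affine[OF T gx IH(1) p] IH(2)
    using finitely_controlled_affine[OF gx IH(1)] insert.hyps by (simp add: algebra_simps)
qed

text \<open>
  Fix a set S of m - 1 elements.  For x outside S, the extended function T(superset_ind (S \<union> {x})) is
  continuous with value 1 at S \<union> {x}, so it stays within \<delta> of 1 at S \<union> {x} \<union> G as soon as G
  avoids a finite set \<Phi> x.  Likewise T(superset_ind S) is near 1 at S \<union> G when G avoids a finite
  set \<Phi>0.  A free set R of n - m + 1 points makes all these estimates hold simultaneously at the
  single point A = S \<union> R.  So the functional that takes f to the value of T f at A has mass about 1 at each of the n - m + 1
  points S \<union> {x}, but total mass only about 1 on the sets including S, hence mass about -(n - m)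
  elsewhere among those sets.
\<close>

lemma extension_operator_norm_ge:
  assumes "1 \<le> m" "m \<le> n" and X: "uncountable X"
    and T: "extension_operator (sigma_cube m X) (sigma_cube n X) T"
  shows "2 * real n - 2 * real m + 1 \<le> op_norm (sigma_cube m X) (sigma_cube n X) T"
proof (rule field_le_epsilon)
  fix \<epsilon> :: real assume "\<epsilon> > 0"
  let ?L = "sigma_cube m X" and ?K = "sigma_cube n X"
  define r where "r = n - m + 1"
  \<comment> \<open>The test function combines r estimates with coefficient 2 and one with coefficient 1.\<close>
  define \<delta> where "\<delta> = \<epsilon> / (2 * real r + 1)"
  have "\<delta> > 0" and \<delta>: "(2 * real r + 1) * \<delta> = \<epsilon>"
    using \<open>\<epsilon> > 0\<close> by (auto simp: \<delta>_def)
  have bd: "bounded_operator ?L ?K T" and ext: "\<And>f p. f \<in> C_space ?L \<Longrightarrow> p \<in> topspace ?L \<Longrightarrow> T f p = f p"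
    using T by (auto simp: extension_operator_def)
  have T_in: "T f \<in> C_space ?K" if "f \<in> C_space ?L" for f
    using bd that by (auto simp: bounded_operator_def)
  have near: "\<exists>\<Phi>. finite \<Phi> \<and> (\<forall>A\<in>small_sets n X. A \<inter> \<Phi> = D \<inter> \<Phi> \<longrightarrow>
      \<bar>T (on_sigma m X (superset_ind D)) (char_fun X A) - 1\<bar> < \<delta>)" if D: "D \<in> small_sets m X" for D
  proof -
    have C: "on_sigma m X (superset_ind D) \<in> C_space ?L"
      using D by (intro on_sigma_in_C_space finitely_controlled_superset_ind) (simp add: small_sets_def)
    have at_D: "T (on_sigma m X (superset_ind D)) (char_fun X D) = 1"
      using ext[OF C char_fun_in_topspace[OF D]] D by (simp add: superset_ind_def)
    have "D \<in> small_sets n X"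
      using D small_sets_mono[OF assms(2)] by blast
    moreover obtain \<Phi> where "finite \<Phi>" "\<And>A B. A \<in> small_sets n X \<Longrightarrow> B \<in> small_sets n X \<Longrightarrow>
        A \<inter> \<Phi> = B \<inter> \<Phi> \<Longrightarrow> \<bar>T (on_sigma m X (superset_ind D)) (char_fun X A) -
          T (on_sigma m X (superset_ind D)) (char_fun X B)\<bar> < \<delta>"
      using finitely_controlledE[OF finitely_controlled_of_C_space[OF T_in[OF C]] \<open>\<delta> > 0\<close>] by metis
    ultimately show ?thesis
      using at_D by (intro exI[of _ \<Phi>]) metis
  qed
  have "infinite X"
    using X countable_finite by blast
  then obtain S where S: "S \<subseteq> X" "finite S" "card S = m - 1"
    using infinite_arbitrarily_large by metis
  have S_small: "S \<in> small_sets m X"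
    using S by (simp add: small_sets_def)
  have Sx_small: "insert x S \<in> small_sets m X" if "x \<in> X" for x
    using S that assms(1) card_insert_le_m1[of m S x] by (simp add: small_sets_def)
  obtain \<Phi>0 where \<Phi>0: "finite \<Phi>0" "\<forall>A\<in>small_sets n X. A \<inter> \<Phi>0 = S \<inter> \<Phi>0 \<longrightarrow>
      \<bar>T (on_sigma m X (superset_ind S)) (char_fun X A) - 1\<bar> < \<delta>"
    using near[OF S_small] by (elim exE conjE)
  have "\<forall>x\<in>X. \<exists>\<Phi>. finite \<Phi> \<and> (\<forall>A\<in>small_sets n X. A \<inter> \<Phi> = insert x S \<inter> \<Phi> \<longrightarrow>
      \<bar>T (on_sigma m X (superset_ind (insert x S))) (char_fun X A) - 1\<bar> < \<delta>)"
    using near Sx_small by blast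
  then obtain \<Phi> where \<Phi>: "\<forall>x\<in>X. finite (\<Phi> x) \<and> (\<forall>A\<in>small_sets n X.
      A \<inter> \<Phi> x = insert x S \<inter> \<Phi> x \<longrightarrow>
      \<bar>T (on_sigma m X (superset_ind (insert x S))) (char_fun X A) - 1\<bar> < \<delta>)"
    by (rule bchoice[THEN exE])
  have "uncountable (X - (S \<union> \<Phi>0))"
    using X S(2) \<Phi>0(1) by (intro uncountable_minus_countable countable_finite) auto
  then obtain R where R: "R \<subseteq> X - (S \<union> \<Phi>0)" "finite R" "card R = r" "\<forall>x\<in>R. \<Phi> x \<inter> R \<subseteq> {x}"
    using free_subset_of_uncountable[of "X - (S \<union> \<Phi>0)" \<Phi> r] \<Phi> by blast
  define A where "A = S \<union> R"
  have "card A = card S + card R"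
    unfolding A_def using S R by (intro card_Un_disjoint) auto
  then have A: "A \<in> small_sets n X"
    using S R assms(1,2) by (auto simp: small_sets_def A_def r_def)
  then have A_top: "char_fun X A \<in> topspace ?K"
    by (rule char_fun_in_topspace)
  \<comment> \<open>This f is -1 at the points S \<union> {x} with x in R, it is 1 at the other sets that include S, and
      it vanishes off these sets.\<close>
  define f where "f = (\<lambda>B. - 2 * (\<Sum>x\<in>R. superset_ind (insert x S) B) + superset_ind S B)"
  have lin: "finitely_controlled m X f \<and> T (on_sigma m X f) (char_fun X A) =
      - 2 * (\<Sum>x\<in>R. T (on_sigma m X (superset_ind (insert x S))) (char_fun X A)) +
      T (on_sigma m X (superset_ind S)) (char_fun X A)"
    unfolding f_def using S(2) R(2)
    by (intro bounded_operator_sum[OF bd _ _ A_top] finitely_controlled_superset_ind) auto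
  then have f_C: "on_sigma m X f \<in> C_space ?L"
    using on_sigma_in_C_space by blast
  have "\<bar>f B\<bar> \<le> 1" if B: "B \<in> small_sets m X" for B
  proof (cases "S \<subseteq> B")
    case False
    then show ?thesis by (simp add: f_def superset_ind_def)
  next
    case True
    \<comment> \<open>B has at most one element besides S, so at most one of the summands is 1.\<close>
    have "(\<Sum>x\<in>R. superset_ind (insert x S) B) = real (card (R \<inter> B))"
      using True R(2) by (simp add: superset_ind_def sum.If_cases Int_def flip: of_nat_sum)
    moreover have "card (R \<inter> B) \<le> card (B - S)"
      using R(1) B by (intro card_mono) (auto simp: small_sets_def)
    moreover have "card (B - S) \<le> 1"
      using True S B assms(1) by (auto simp: card_Diff_subset small_sets_def)
    ultimately show ?thesis
      using True by (auto simp: f_def superset_ind_def)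
  qed
  then have f_norm: "C_norm ?L (on_sigma m X f) \<le> 1"
    by (intro C_norm_le f_C) simp
  have "1 - \<delta> \<le> T (on_sigma m X (superset_ind (insert x S))) (char_fun X A)" if x: "x \<in> R" for x
  proof -
    have "A \<inter> \<Phi> x = insert x S \<inter> \<Phi> x"
      using R(4) x by (auto simp: A_def)
    then have "\<bar>T (on_sigma m X (superset_ind (insert x S))) (char_fun X A) - 1\<bar> < \<delta>"
      using \<Phi> A x R(1) by blast
    then show ?thesis by linarith
  qed
  then have "real r * (1 - \<delta>) \<le> (\<Sum>x\<in>R. T (on_sigma m X (superset_ind (insert x S))) (char_fun X A))"
    using sum_bounded_below[of R "1 - \<delta>"] R(3) by simp
  moreover have "T (on_sigma m X (superset_ind S)) (char_fun X A) < 1 + \<delta>"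
  proof -
    have "A \<inter> \<Phi>0 = S \<inter> \<Phi>0"
      using R(1) by (auto simp: A_def)
    then have "\<bar>T (on_sigma m X (superset_ind S)) (char_fun X A) - 1\<bar> < \<delta>"
      using \<Phi>0(2) A by blast
    then show ?thesis by linarith
  qed
  moreover have "real r * (1 - \<delta>) = real r - real r * \<delta>" "2 * (real r * \<delta>) + \<delta> = \<epsilon>"
    using \<delta> by (simp_all add: algebra_simps)
  ultimately have "2 * real r - 1 - \<epsilon> \<le> \<bar>T (on_sigma m X f) (char_fun X A)\<bar>"
    using lin by linarith
  also have "\<dots> \<le> C_norm ?K (T (on_sigma m X f))"
    by (intro abs_le_C_norm T_in f_C A_top)
  also have "\<dots> \<le> op_norm ?L ?K T"
    unfolding op_norm_def
  proof (rule cSUP_upper)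
    show "on_sigma m X f \<in> {f \<in> C_space ?L. C_norm ?L f \<le> 1}"
      using f_C f_norm by simp
    obtain C where C: "\<And>f. f \<in> C_space ?L \<Longrightarrow> C_norm ?K (T f) \<le> C * C_norm ?L f"
      using bd unfolding bounded_operator_def by blast
    have "C_norm ?K (T f) \<le> \<bar>C\<bar>" if "f \<in> C_space ?L" "C_norm ?L f \<le> 1" for f
    proof -
      have "C * C_norm ?L f \<le> \<bar>C\<bar> * 1"
        using that C_norm_nonneg[of f m X] by (intro mult_mono) auto
      then show ?thesis using C[OF that(1)] by linarith
    qed
    then show "bdd_above ((\<lambda>f. C_norm ?K (T f)) ` {f \<in> C_space ?L. C_norm ?L f \<le> 1})"
      by (intro bdd_aboveI2[of _ _ "\<bar>C\<bar>"]) simp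
  qed
  finally show "2 * real n - 2 * real m + 1 \<le> op_norm ?L ?K T + \<epsilon>"
    using assms(2) by (simp add: r_def of_nat_diff)
qed

section \<open>Sets of cardinality aleph one\<close>

lemma uncountable_of_card_aleph1:
  assumes "(card_of X, cardSuc natLeq) \<in> ordIso"
  shows "uncountable X"
proof
  assume "countable X"
  then have "(card_of X, natLeq) \<in> ordLeq"
    by (simp add: countable_card_le_natLeq)
  moreover have "(natLeq, cardSuc natLeq) \<in> ordLess"
    by (intro cardSuc_greater natLeq_Card_order)
  ultimately have "(card_of X, cardSuc natLeq) \<in> ordLess"
    by (rule ordLeq_ordLess_trans)
  then show False
    using assms not_ordLess_ordIso by blast
qed

text \<open>
  The canonical well-order of X is a cardinal, so its proper initial segments have cardinality below
  \<aleph>_1.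
\<close>

lemma countable_initial_segments_of_card_aleph1:
  assumes "(card_of X, cardSuc natLeq) \<in> ordIso"
  shows "countable_initial_segments X (underS (card_of X))"
proof -
  have wo: "Well_order (card_of X)" and F: "Field (card_of X) = X"
    by (rule card_of_Well_order, rule Field_card_of)
  then have lin: "trans (card_of X)" "antisym (card_of X)" "Total (card_of X)"
    by (simp_all add: order_on_defs)
  show ?thesis
  proof
    fix c assume "c \<in> X"
    then have "(card_of (underS (card_of X) c), card_of X) \<in> ordLess"
      by (intro card_of_underS card_of_Card_order) (simp add: F)
    then have "(card_of (underS (card_of X) c), cardSuc natLeq) \<in> ordLess"
      using assms by (rule ordLess_ordIso_trans)
    then have "(card_of (underS (card_of X) c), natLeq) \<in> ordLeq"
      by (rule iffD1[OF cardSuc_ordLeq_ordLess[OF natLeq_Card_order card_of_Card_order]])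
    then show "countable (underS (card_of X) c)"
      by (simp add: countable_card_le_natLeq)
  next
    fix c show "c \<notin> underS (card_of X) c"
      by (simp add: underS_def)
  next
    fix c d assume "d \<in> underS (card_of X) c"
    then show "underS (card_of X) d \<subseteq> underS (card_of X) c"
      using lin(1,2) by (auto simp: underS_def dest: transD antisymD)
  next
    fix c d assume "c \<in> X" "d \<in> X" "c \<noteq> d"
    then show "c \<in> underS (card_of X) d \<or> d \<in> underS (card_of X) c"
      using lin(3) by (auto simp: underS_def total_on_def F)
  qed
qed

theorem theorem4p1:
  fixes m n :: nat and X :: "'a set"
  assumes "1 \<le> m" and "m < n"
    and "(card_of X, cardSuc natLeq) \<in> ordIso"
  shows "eta (sigma_cube m X) (sigma_cube n X) = ereal (2 * real n - 2 * real m + 1)"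
proof (rule antisym)
  interpret countable_initial_segments X "underS (card_of X)"
    using assms(3) by (rule countable_initial_segments_of_card_aleph1)
  show "eta (sigma_cube m X) (sigma_cube n X) \<le> ereal (2 * real n - 2 * real m + 1)"
    using assms(1,2) by (intro eta_sigma_cube_le) auto
  show "ereal (2 * real n - 2 * real m + 1) \<le> eta (sigma_cube m X) (sigma_cube n X)"
    unfolding eta_def
    using assms(1,2) uncountable_of_card_aleph1[OF assms(3)] extension_operator_norm_ge[of m n X]
    by (intro INF_greatest) auto
qed

end
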